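(* Let $f\in S_{\mu,L}(\mathbb{R}^d)$ with minimizer $x^*$ and $f^*=f(x^* )$, and consider the noisy accelerated gradient iterations $$y_k=(1+\beta)x_k-\beta x_{k-1},\qquad x_{k+1}=y_k-\alpha(\nabla f(y_k)+w_k),$$ with constant stepsize $\alpha\in(0,1/L]$ and $\beta=\beta(\alpha)=\frac{1-\sqrt{\alpha\mu}}{1+\sqrt{\alpha\mu}}$, where $\{w_k\}$ satisfies the noise assumption of the context. Let $\rho_{AG}(\alpha)=\sqrt{1-\sqrt{\alpha\mu}}$, $R_{AG}(\alpha)=\frac{\alpha d}{2(1-\rho_{AG}(\alpha)^2)}(1+\alpha L)$ and $\psi_0=V_{P,1}(\xi_0)$ (defined in the context). Then for all $k\ge0$, $$\mathbb{E}[f(x_k)-f^*]\le\rho_{AG}(\alpha)^{2k}\,\psi_0+\left(1-\rho_{AG}(\alpha)^{2k}\right)\sigma^2R_{AG}(\alpha).$$ Hence $\mathcal{J}\le R_{AG}(\alpha)=\frac{\sqrt\alpha\,d}{2\sqrt\mu}(1+\alpha L)$, where $\mathcal{J}=\limsup_{k\to\infty}\frac1{\sigma^2}\mathbb{E}[f(x_k)-f^*]$.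
   Context: For $0<\mu\le L$, $S_{\mu,L}(\mathbb{R}^d)$ is the set of continuously differentiable $f:\mathbb{R}^d\to\mathbb{R}$ with $\frac L2\|x-y\|^2\ge f(x)-f(y)-\nabla f(y)^\top(x-y)\ge\frac\mu2\|x-y\|^2$ for all $x,y$. With $\xi_k=[x_k^\top\;x_{k-1}^\top]^\top$ and $\xi^*=[x^{*\top}\;x^{*\top}]^\top$, $V_{P,1}(\xi_0)=(\xi_0-\xi^* )^\top P(\xi_0-\xi^* )+f(x_0)-f^*$, where $P=\tilde P(\alpha)\otimes I_d$ and $\tilde P(\alpha)=vv^\top$ with $v=\begin{bmatrix}\sqrt{\tfrac1{2\alpha}}\\ \sqrt{\tfrac\mu2}-\sqrt{\tfrac1{2\alpha}}\end{bmatrix}$. Noise assumption: for some $\sigma>0$ and every $k\ge0$, the random vector $w_k\in\mathbb{R}^d$ has zero mean, is independent of $\{\xi_i\}_{i=1}^k$ and $\{y_i\}_{i=1}^k$, and $\mathbb{E}[w_kw_k^\top]=\sigma^2I_d$; $x_0,x_{-1}$ are deterministic. Convention $0^0=1$. *)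

theory Defs
  imports "HOL-Probability.Probability"
begin

definition grad :: "('a::euclidean_space \<Rightarrow> real) \<Rightarrow> 'a \<Rightarrow> 'a" where
  "grad f x = (THE D. GDERIV f x :> D)"

definition smooth_strongly_convex :: "real \<Rightarrow> real \<Rightarrow> ('a::euclidean_space \<Rightarrow> real) set" where
  "smooth_strongly_convex \<mu> L =
     {f. (\<forall>x. f differentiable (at x)) \<and> continuous_on UNIV (grad f) \<and>
         (\<forall>x y. L / 2 * (norm (x - y))\<^sup>2 \<ge> f x - f y - grad f y \<bullet> (x - y) \<and>
                f x - f y - grad f y \<bullet> (x - y) \<ge> \<mu> / 2 * (norm (x - y))\<^sup>2)}"

definition outer_prod :: "real ^ 'm \<Rightarrow> real ^ 'n \<Rightarrow> real ^ 'n ^ 'm" where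
  "outer_prod u v = (\<chi> i j. u $ i * v $ j)"

(* Kronecker product; a pair (block, offset) indexes the rows and the columns. *)
definition kron :: "real ^ 'n ^ 'm \<Rightarrow> real ^ 'q ^ 'p \<Rightarrow> real ^ ('n \<times> 'q) ^ ('m \<times> 'p)" where
  "kron A B = (\<chi> r c. A $ fst r $ fst c * B $ snd r $ snd c)"

(* The stacked vector [u; v].  The elements of the index type 2 are 1 and 2 (= 0),
   so the branch "else" is block number 2. *)
definition stack :: "real ^ 'd \<Rightarrow> real ^ 'd \<Rightarrow> real ^ (2 \<times> 'd)" where
  "stack u v = (\<chi> r. if fst r = 1 then u $ snd r else v $ snd r)"

definition AG_beta :: "real \<Rightarrow> real \<Rightarrow> real" where
  "AG_beta \<mu> \<alpha> = (1 - sqrt (\<alpha> * \<mu>)) / (1 + sqrt (\<alpha> * \<mu>))"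

definition AG_rho :: "real \<Rightarrow> real \<Rightarrow> real" where
  "AG_rho \<mu> \<alpha> = sqrt (1 - sqrt (\<alpha> * \<mu>))"

definition AG_R :: "real \<Rightarrow> real \<Rightarrow> nat \<Rightarrow> real \<Rightarrow> real" where
  "AG_R \<mu> L d \<alpha> = \<alpha> * real d / (2 * (1 - (AG_rho \<mu> \<alpha>)\<^sup>2)) * (1 + \<alpha> * L)"

definition P_vec :: "real \<Rightarrow> real \<Rightarrow> real ^ 2" where
  "P_vec \<mu> \<alpha> = vector [sqrt (1 / (2 * \<alpha>)), sqrt (\<mu> / 2) - sqrt (1 / (2 * \<alpha>))]"

definition P_tilde :: "real \<Rightarrow> real \<Rightarrow> real ^ 2 ^ 2" where
  "P_tilde \<mu> \<alpha> = outer_prod (P_vec \<mu> \<alpha>) (P_vec \<mu> \<alpha>)"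

definition P_mat :: "real \<Rightarrow> real \<Rightarrow> real ^ (2 \<times> 'd::finite) ^ (2 \<times> 'd)" where
  "P_mat \<mu> \<alpha> = kron (P_tilde \<mu> \<alpha>) (mat 1 :: real ^ 'd ^ 'd)"

(* V_{P,1} at the point \<xi> = [u; v], where u is the current and v the previous iterate. *)
definition V_P1 ::
  "real ^ (2 \<times> 'd) ^ (2 \<times> 'd) \<Rightarrow> (real ^ 'd \<Rightarrow> real) \<Rightarrow> real ^ 'd \<Rightarrow> real ^ 'd \<Rightarrow> real ^ 'd \<Rightarrow> real"
where
  "V_P1 P f xs u v =
     (stack u v - stack xs xs) \<bullet> (P *v (stack u v - stack xs xs)) + f u - f xs"

(* For each k, w k is jointly independent of all of \<xi> 1, ..., \<xi> k, y 1, ..., y k, that is, of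
   the sigma-algebra these generate (the trivial one for k = 0).  Independence is stated for the
   generated sigma-algebras because indep_var requires both variables to have the same type. *)
definition noise_assumption ::
  "'w measure \<Rightarrow> real \<Rightarrow> (nat \<Rightarrow> 'w \<Rightarrow> real ^ (2 \<times> 'd)) \<Rightarrow> (nat \<Rightarrow> 'w \<Rightarrow> real ^ 'd) \<Rightarrow>
   (nat \<Rightarrow> 'w \<Rightarrow> real ^ 'd) \<Rightarrow> bool"
where
  "noise_assumption M \<sigma> \<xi> y w \<longleftrightarrow>
     (\<forall>k. w k \<in> borel_measurable M \<and>
          has_bochner_integral M (w k) 0 \<and>
          has_bochner_integral M (\<lambda>\<omega>. outer_prod (w k \<omega>) (w k \<omega>)) (\<sigma>\<^sup>2 *\<^sub>R mat 1) \<and>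
          prob_space.indep_set M
            (sets (vimage_algebra (space M) (w k) borel))
            (sets (vimage_algebra (space M) (\<lambda>\<omega>. \<lambda>i\<in>{1..k}. (\<xi> i \<omega>, y i \<omega>))
                     (PiM {1..k} (\<lambda>_. borel)))))"

definition noise_robustness ::
  "'w measure \<Rightarrow> real \<Rightarrow> (real ^ 'd \<Rightarrow> real) \<Rightarrow> real ^ 'd \<Rightarrow> (int \<Rightarrow> 'w \<Rightarrow> real ^ 'd) \<Rightarrow> ereal"
where
  "noise_robustness M \<sigma> f xs x =
     limsup (\<lambda>k. ereal (1 / \<sigma>\<^sup>2 * (LINT \<omega>|M. f (x (int k) \<omega>) - f xs)))"

end

theory Submission
  imports Defs
begin

text \<open>
  Write s for the square root of \<open>\<alpha> \<mu>\<close>. Since P is a rank-one matrix tensored with the identity, V is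
  \<open>|p|\<^sup>2 / (2 \<alpha>) + f(u) - f(xs)\<close> with \<open>p = (u - xs) - (1 - s)(v - xs)\<close>, u and v being the current and the
  previous iterate and xs the minimizer. The step size and the momentum are tuned so that one
  noiseless step replaces p by \<open>(1 - s) p + s (s (y - xs)) - \<alpha> \<nabla>f(y)\<close>, a convex combination followed by a gradient step.
  Adding the descent inequality at y to the strong convexity inequalities from y towards \<open>x\<^sub>k\<close>
  (weight 1 - s) and towards xs (weight s) makes V contract by 1 - s pathwise, up to a term linear
  in \<open>w\<^sub>k\<close>, whose coefficient depends on \<open>x\<^sub>k\<close> and \<open>y\<^sub>k\<close> only and which therefore has mean zero, and the
  term \<open>\<alpha> (1 + \<alpha> L) |w\<^sub>k|\<^sup>2 / 2\<close>. The claim follows by solving the resulting affine recursion.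
\<close>

section \<open>Closed form of the Lyapunov function\<close>

definition lyapunov :: "real \<Rightarrow> real \<Rightarrow> ('a::euclidean_space \<Rightarrow> real) \<Rightarrow> 'a \<Rightarrow> 'a \<Rightarrow> 'a \<Rightarrow> real" where
  "lyapunov \<mu> \<alpha> f xs u v =
     (norm ((u - xs) - (1 - sqrt (\<alpha> * \<mu>)) *\<^sub>R (v - xs)))\<^sup>2 / (2 * \<alpha>) + f u - f xs"

lemma sum_UNIV_2_times:
  "(\<Sum>r\<in>UNIV. h (r :: 2 \<times> 'd::finite)) = (\<Sum>i\<in>UNIV. h (1, i)) + (\<Sum>i\<in>UNIV. h (2, i))"
proof -
  have "(\<Sum>r\<in>UNIV. h r) = (\<Sum>k\<in>UNIV. \<Sum>i\<in>UNIV. h (k, i))"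
    unfolding sum.cartesian_product by simp
  then show ?thesis by (simp add: sum_2)
qed

lemma inner_stack: "stack a b \<bullet> stack c d = a \<bullet> c + b \<bullet> d"
  by (simp add: inner_vec_def sum_UNIV_2_times stack_def)

text \<open>The identity factor keeps a single offset, so the rank-one factor acts on whole blocks:
  \<open>q\<close> merges the two blocks into one combination and \<open>p\<close> redistributes it.
  For \<open>p = q\<close> the quadratic form is therefore the squared norm of one vector.\<close>

lemma kron_outer_prod_mult_stack:
  fixes p :: "real ^ 2" and q :: "real ^ 2" and a b :: "real ^ 'd"
  shows "kron (outer_prod p q) (mat 1) *v stack a b =
    stack (p $ 1 *\<^sub>R (q $ 1 *\<^sub>R a + q $ 2 *\<^sub>R b)) (p $ 2 *\<^sub>R (q $ 1 *\<^sub>R a + q $ 2 *\<^sub>R b))"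
proof -
  have delta: "(\<Sum>l\<in>UNIV. c * mat 1 $ j $ l * z $ l) = c * z $ j" for c j and z :: "real ^ 'd"
  proof -
    have "(\<Sum>l\<in>UNIV. c * mat 1 $ j $ l * z $ l) = c * (mat 1 *v z) $ j"
      by (simp only: matrix_vector_mult_def vec_lambda_beta sum_distrib_left mult.assoc)
    then show ?thesis by simp
  qed
  have "(kron (outer_prod p q) (mat 1) *v stack a b) $ r = stack (p $ 1 *\<^sub>R (q $ 1 *\<^sub>R a + q $ 2 *\<^sub>R b))
      (p $ 2 *\<^sub>R (q $ 1 *\<^sub>R a + q $ 2 *\<^sub>R b)) $ r" for r
  proof -
    obtain i j where r: "r = (i, j)" by (cases r)
    have "(kron (outer_prod p q) (mat 1) *v stack a b) $ r = p $ i * q $ 1 * a $ j + p $ i * q $ 2 * b $ j"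
      by (simp add: r matrix_vector_mult_def sum_UNIV_2_times kron_def outer_prod_def stack_def delta)
    also have "\<dots> = p $ i * (q $ 1 * a $ j + q $ 2 * b $ j)" by (simp only: distrib_left mult.assoc)
    finally show ?thesis
      using exhaust_2[of i] by (auto simp: r stack_def)
  qed
  then show ?thesis unfolding vec_eq_iff by blast
qed

lemma V_P1_eq_lyapunov:
  assumes "0 < \<alpha>" and "0 \<le> \<mu>"
  shows "V_P1 (P_mat \<mu> \<alpha>) f xs u v = lyapunov \<mu> \<alpha> f xs u v"
proof -
  define a where "a = sqrt (1 / (2 * \<alpha>))"
  define s where "s = sqrt (\<alpha> * \<mu>)"
  have a2: "a * a = 1 / (2 * \<alpha>)" using assms by (simp add: a_def)
  \<comment> \<open>Factoring \<open>a\<close> out of both entries of \<open>P_vec\<close> leaves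
    the weights 1 and -(1 - s) that appear in \<open>lyapunov\<close>.\<close>
  have "sqrt (\<mu> / 2) = a * s"
    using assms by (simp add: a_def s_def real_sqrt_mult[symmetric])
  then have v: "P_vec \<mu> \<alpha> $ 1 = a" "P_vec \<mu> \<alpha> $ 2 = - (a * (1 - s))"
    by (simp_all add: P_vec_def a_def algebra_simps)
  have st: "stack u v - stack xs xs = stack (u - xs) (v - xs)"
    by (simp add: stack_def vec_eq_iff)
  have comb: "a *\<^sub>R (u - xs) + (- (a * (1 - s))) *\<^sub>R (v - xs) = a *\<^sub>R ((u - xs) - (1 - s) *\<^sub>R (v - xs))"
    by (simp add: algebra_simps)
  have "stack (u - xs) (v - xs) \<bullet> (P_mat \<mu> \<alpha> *v stack (u - xs) (v - xs)) =
     (a *\<^sub>R (u - xs) + (- (a * (1 - s))) *\<^sub>R (v - xs)) \<bullet> (a *\<^sub>R (u - xs) + (- (a * (1 - s))) *\<^sub>R (v - xs))"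
    unfolding P_mat_def P_tilde_def kron_outer_prod_mult_stack inner_stack v
    by (simp only: inner_add_left inner_scaleR_left inner_scaleR_right)
  also have "\<dots> = (a * a) * (norm ((u - xs) - (1 - s) *\<^sub>R (v - xs)))\<^sup>2"
    unfolding comb by (simp add: power2_norm_eq_inner)
  finally show ?thesis
    by (simp add: V_P1_def lyapunov_def st a2 s_def)
qed

section \<open>Consequences of smoothness and strong convexity\<close>

lemma smooth_strongly_convexD:
  assumes "f \<in> smooth_strongly_convex \<mu> L"
  shows "f u \<le> f v + grad f v \<bullet> (u - v) + L / 2 * (norm (u - v))\<^sup>2"
    and "f v + grad f v \<bullet> (u - v) + \<mu> / 2 * (norm (u - v))\<^sup>2 \<le> f u"
    and "continuous_on UNIV f" and "continuous_on UNIV (grad f)"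
proof -
  have "f u - f v - grad f v \<bullet> (u - v) \<le> L / 2 * (norm (u - v))\<^sup>2"
    "\<mu> / 2 * (norm (u - v))\<^sup>2 \<le> f u - f v - grad f v \<bullet> (u - v)"
    using assms unfolding smooth_strongly_convex_def by blast+
  then show "f u \<le> f v + grad f v \<bullet> (u - v) + L / 2 * (norm (u - v))\<^sup>2"
    and "f v + grad f v \<bullet> (u - v) + \<mu> / 2 * (norm (u - v))\<^sup>2 \<le> f u"
    by linarith+
  have "f differentiable (at x)" for x
    using assms unfolding smooth_strongly_convex_def by blast
  then show "continuous_on UNIV f"
    by (intro continuous_at_imp_continuous_on ballI differentiable_imp_continuous_within)
  show "continuous_on UNIV (grad f)"
    using assms unfolding smooth_strongly_convex_def by blast
qed

text \<open>Growth bounds around the minimizer, which later turn second moments of the iterates into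
  integrability of the function gap and of the gradient. Both come from the quadratic upper bound: a
  gradient step cannot fall below the minimum, which also forces the gradient at \<open>xs\<close>
  to vanish.\<close>

lemma norm_grad_le_of_minimizer:
  assumes f: "f \<in> smooth_strongly_convex \<mu> L" and "0 < L" and min: "\<forall>z. f xs \<le> f z"
  shows "f u - f xs \<le> L / 2 * (norm (u - xs))\<^sup>2" and "norm (grad f u) \<le> L * norm (u - xs)"
proof -
  \<comment> \<open>Compare the minimum with the value after a gradient step of length 1 / L.\<close>
  have descent: "(norm (grad f v))\<^sup>2 / (2 * L) \<le> f v - f xs" for v
  proof -
    have "f xs \<le> f (v - (1 / L) *\<^sub>R grad f v)" using min by simp
    also have "\<dots> \<le> f v - (norm (grad f v))\<^sup>2 / (2 * L)"
      using smooth_strongly_convexD(1)[OF f, of "v - (1 / L) *\<^sub>R grad f v" v] \<open>0 < L\<close>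
      by (simp add: power2_norm_eq_inner[symmetric] power_divide field_simps power2_eq_square)
    finally show ?thesis by simp
  qed
  have "grad f xs = 0" using descent[of xs] \<open>0 < L\<close> by (simp add: field_simps)
  then show le: "f u - f xs \<le> L / 2 * (norm (u - xs))\<^sup>2"
    using smooth_strongly_convexD(1)[OF f, of u xs] by simp
  have "(norm (grad f u))\<^sup>2 / (2 * L) \<le> L / 2 * (norm (u - xs))\<^sup>2"
    using descent[of u] le by linarith
  then have "(norm (grad f u))\<^sup>2 \<le> (L * norm (u - xs))\<^sup>2"
    using \<open>0 < L\<close> by (simp add: field_simps power2_eq_square)
  then show "norm (grad f u) \<le> L * norm (u - xs)"
    by (rule power2_le_imp_le) (use \<open>0 < L\<close> in simp)
qed

section \<open>Pathwise contraction of the Lyapunov function in one step\<close>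

lemma norm_convex_combination_power2_le:
  fixes p q :: "'a::real_inner"
  assumes "0 \<le> t" "t \<le> 1"
  shows "(norm ((1 - t) *\<^sub>R p + t *\<^sub>R q))\<^sup>2 \<le> (1 - t) * (norm p)\<^sup>2 + t * (norm q)\<^sup>2"
proof -
  have "(1 - t) * (norm p)\<^sup>2 + t * (norm q)\<^sup>2 - (norm ((1 - t) *\<^sub>R p + t *\<^sub>R q))\<^sup>2
     = (1 - t) * t * (norm (p - q))\<^sup>2"
    unfolding power2_norm_eq_inner
    by (simp add: algebra_simps inner_commute)
  then show ?thesis using assms
    by (smt (verit) mult_nonneg_nonneg zero_le_power2)
qed

text \<open>Here \<open>w\<close> is an arbitrary vector, so no probability is involved yet. Of the
  terms linear in \<open>w\<close>, the gradient part of the squared norm cancels against the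
  first-order part of the smoothness bound; what survives is the second-order cross term of
  smoothness and the product with the momentum vector.\<close>

lemma lyapunov_step:
  fixes f :: "'a::euclidean_space \<Rightarrow> real"
  assumes f: "f \<in> smooth_strongly_convex \<mu> L"
    and "0 < \<mu>" "0 < \<alpha>" "\<alpha> * \<mu> \<le> 1" "\<alpha> * L \<le> 1"
    and y: "y = (1 + AG_beta \<mu> \<alpha>) *\<^sub>R u - AG_beta \<mu> \<alpha> *\<^sub>R v"
    and u': "u' = y - \<alpha> *\<^sub>R (grad f y + w)"
  shows "lyapunov \<mu> \<alpha> f xs u' u \<le> (1 - sqrt (\<alpha> * \<mu>)) * lyapunov \<mu> \<alpha> f xs u v
     + w \<bullet> ((L * \<alpha>\<^sup>2) *\<^sub>R grad f y - ((y - xs) - (1 - sqrt (\<alpha> * \<mu>)) *\<^sub>R (u - xs)))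
     + \<alpha> / 2 * (1 + \<alpha> * L) * (norm w)\<^sup>2"
proof -
  define s where "s = sqrt (\<alpha> * \<mu>)"
  define g where "g = grad f y"
  define Y where "Y = y - xs"
  define U where "U = u - xs"
  \<comment> \<open>\<open>p\<close> is the vector measured by \<open>lyapunov\<close> at the
    current pair; \<open>p0\<close> is its successor before gradient and noise are
    subtracted.\<close>
  define p where "p = U - (1 - s) *\<^sub>R (v - xs)"
  define p0 where "p0 = Y - (1 - s) *\<^sub>R U"
  have s: "0 < s" "s \<le> 1" "s\<^sup>2 = \<alpha> * \<mu>"
    using assms by (auto simp: s_def)
  \<comment> \<open>The momentum parameter enters only here: multiplying by 1 + s clears the
    denominator of \<open>AG_beta\<close> and eliminates the previous iterate
    \<open>v\<close>.\<close>
  have p_eq: "p = (1 + s) *\<^sub>R Y - U"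
  proof -
    have b: "(1 + s) * AG_beta \<mu> \<alpha> = 1 - s" "(1 + s) * (1 + AG_beta \<mu> \<alpha>) = 2"
      using s by (simp_all add: AG_beta_def s_def[symmetric] field_simps)
    have "Y = (1 + AG_beta \<mu> \<alpha>) *\<^sub>R U - AG_beta \<mu> \<alpha> *\<^sub>R (v - xs)"
      by (simp add: Y_def U_def y algebra_simps)
    then have "(1 + s) *\<^sub>R Y = 2 *\<^sub>R U - (1 - s) *\<^sub>R (v - xs)"
      by (simp only: scaleR_right_diff_distrib scaleR_scaleR b)
    then show ?thesis by (simp add: p_def scaleR_2)
  qed
  \<comment> \<open>The coefficients of \<open>Y\<close> match because (1 - s)(1 + s) + s^2 =
    1.\<close>
  have "p0 = (1 - s) *\<^sub>R p + s *\<^sub>R (s *\<^sub>R Y)"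
    unfolding p_eq p0_def by (simp add: algebra_simps)
  then have "(norm p0)\<^sup>2 \<le> (1 - s) * (norm p)\<^sup>2 + s * (norm (s *\<^sub>R Y))\<^sup>2"
    using norm_convex_combination_power2_le[of s p "s *\<^sub>R Y"] s by simp
  also have "(norm (s *\<^sub>R Y))\<^sup>2 = \<alpha> * \<mu> * (norm Y)\<^sup>2" using s by (simp add: power_mult_distrib)
  finally have "(norm p0)\<^sup>2 / (2 * \<alpha>) \<le> ((1 - s) * (norm p)\<^sup>2 + s * (\<alpha> * \<mu> * (norm Y)\<^sup>2)) / (2 * \<alpha>)"
    using \<open>0 < \<alpha>\<close> by (intro divide_right_mono) auto
  also have "\<dots> = (1 - s) * ((norm p)\<^sup>2 / (2 * \<alpha>)) + s * \<mu> / 2 * (norm Y)\<^sup>2"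
    using \<open>0 < \<alpha>\<close> by (simp add: field_simps)
  finally have momentum: "(norm p0)\<^sup>2 / (2 * \<alpha>) \<le> (1 - s) * ((norm p)\<^sup>2 / (2 * \<alpha>)) + s * \<mu> / 2 * (norm Y)\<^sup>2" .

  \<comment> \<open>Towards \<open>u\<close> plain convexity suffices; the quadratic gain is
    discarded.\<close>
  have "f y + g \<bullet> (U - Y) \<le> f u"
  proof -
    have "f y + grad f y \<bullet> (u - y) + \<mu> / 2 * (norm (u - y))\<^sup>2 \<le> f u"
      by (rule smooth_strongly_convexD(2)[OF f])
    moreover have "0 \<le> \<mu> / 2 * (norm (u - y))\<^sup>2" using \<open>0 < \<mu>\<close> by simp
    moreover have "U - Y = u - y" by (simp add: U_def Y_def)
    ultimately show ?thesis by (simp add: g_def)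
  qed
  then have below_u: "(1 - s) * (f y + g \<bullet> (U - Y)) \<le> (1 - s) * f u"
    using s by (intro mult_left_mono) auto
  \<comment> \<open>Towards \<open>xs\<close> the quadratic gain is kept: weighted by s, it pays for
    the last term of \<open>momentum\<close>.\<close>
  have "f y - g \<bullet> Y + \<mu> / 2 * (norm Y)\<^sup>2 \<le> f xs"
  proof -
    have "xs - y = - Y" by (simp add: Y_def)
    then show ?thesis
      using smooth_strongly_convexD(2)[OF f, of y xs] by (simp add: g_def)
  qed
  then have below_xs: "s * (f y - g \<bullet> Y + \<mu> / 2 * (norm Y)\<^sup>2) \<le> s * f xs"
    using s by (intro mult_left_mono) auto
  \<comment> \<open>Since p0 = s Y - (1 - s)(U - Y), the weights s and 1 - s make the two gradient
    terms add up to the product with \<open>p0\<close>.\<close>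
  have "g \<bullet> p0 = s * (g \<bullet> Y) - (1 - s) * (g \<bullet> (U - Y))"
    by (simp add: p0_def inner_diff_right) (simp add: algebra_simps)
  with below_u below_xs have "f y - f xs - g \<bullet> p0 + s * \<mu> / 2 * (norm Y)\<^sup>2 \<le> (1 - s) * (f u - f xs)"
    by (simp add: left_diff_distrib right_diff_distrib distrib_left)
  moreover have "(1 - s) * lyapunov \<mu> \<alpha> f xs u v = (1 - s) * ((norm p)\<^sup>2 / (2 * \<alpha>)) + (1 - s) * (f u - f xs)"
    unfolding lyapunov_def s_def[symmetric] U_def[symmetric] p_def[symmetric] by (simp add: algebra_simps)
  ultimately have contraction:
    "(norm p0)\<^sup>2 / (2 * \<alpha>) + f y - f xs - g \<bullet> p0 \<le> (1 - s) * lyapunov \<mu> \<alpha> f xs u v"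
    using momentum by linarith

  have u'y: "u' - y = - (\<alpha> *\<^sub>R (g + w))" by (simp add: u' g_def)
  have smooth: "f u' \<le> f y - \<alpha> * (g \<bullet> (g + w)) + L / 2 * (\<alpha>\<^sup>2 * (norm (g + w))\<^sup>2)"
    using smooth_strongly_convexD(1)[OF f, of u' y] unfolding u'y
    by (simp add: g_def power_mult_distrib)
  have "(u' - xs) - (1 - s) *\<^sub>R (u - xs) = p0 - \<alpha> *\<^sub>R (g + w)"
    by (simp add: p0_def Y_def U_def u' g_def algebra_simps)
  then have "lyapunov \<mu> \<alpha> f xs u' u = (norm (p0 - \<alpha> *\<^sub>R (g + w)))\<^sup>2 / (2 * \<alpha>) + f u' - f xs"
    by (simp add: lyapunov_def s_def)
  also have "(norm (p0 - \<alpha> *\<^sub>R (g + w)))\<^sup>2 =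
      (norm p0)\<^sup>2 - 2 * \<alpha> * (p0 \<bullet> (g + w)) + \<alpha>\<^sup>2 * (norm (g + w))\<^sup>2"
    unfolding power2_norm_eq_inner
      inner_diff_left inner_diff_right inner_scaleR_left inner_scaleR_right
    by (simp add: inner_commute power2_eq_square right_diff_distrib)
  also have "\<dots> / (2 * \<alpha>) = (norm p0)\<^sup>2 / (2 * \<alpha>) - p0 \<bullet> (g + w) + \<alpha> / 2 * (norm (g + w))\<^sup>2"
    using \<open>0 < \<alpha>\<close> by (simp add: add_divide_distrib diff_divide_distrib power2_eq_square)
  finally have V: "lyapunov \<mu> \<alpha> f xs u' u = (norm p0)\<^sup>2 / (2 * \<alpha>) - p0 \<bullet> (g + w)
      + \<alpha> / 2 * (norm (g + w))\<^sup>2 + f u' - f xs" .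
  have expand: "(norm (g + w))\<^sup>2 = (norm g)\<^sup>2 + 2 * (g \<bullet> w) + (norm w)\<^sup>2"
    "g \<bullet> (g + w) = (norm g)\<^sup>2 + g \<bullet> w" "p0 \<bullet> (g + w) = g \<bullet> p0 + w \<bullet> p0"
    "w \<bullet> ((L * \<alpha>\<^sup>2) *\<^sub>R g - p0) = L * \<alpha>\<^sup>2 * (g \<bullet> w) - w \<bullet> p0"
    by (simp_all add: power2_norm_eq_inner inner_add_left inner_add_right inner_diff_right inner_commute)
  \<comment> \<open>Comparison of coefficients over the reals. That of \<open>gg\<close> is
    \<alpha>/2 - \<alpha> + L \<alpha>^2/2 = -(\<alpha>/2)(1 - \<alpha> L), that of
    \<open>ww\<close> is \<alpha>/2 + L \<alpha>^2/2, and the two terms \<alpha> \<open>gw\<close>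
    cancel.\<close>
  have combine: "a - (gp + wp) + \<alpha> / 2 * (gg + 2 * gw + ww) + F - fx \<le>
      (a + fy - fx - gp) + (L * \<alpha>\<^sup>2 * gw - wp) + \<alpha> / 2 * (1 + \<alpha> * L) * ww - \<alpha> / 2 * (1 - \<alpha> * L) * gg"
    if "F \<le> fy - \<alpha> * (gg + gw) + L / 2 * (\<alpha>\<^sup>2 * (gg + 2 * gw + ww))"
    for a gp wp gg gw ww F fx fy :: real
    using that by (simp add: field_simps power2_eq_square)
  have "lyapunov \<mu> \<alpha> f xs u' u \<le>
      ((norm p0)\<^sup>2 / (2 * \<alpha>) + f y - f xs - g \<bullet> p0) + w \<bullet> ((L * \<alpha>\<^sup>2) *\<^sub>R g - p0)
      + \<alpha> / 2 * (1 + \<alpha> * L) * (norm w)\<^sup>2 - \<alpha> / 2 * (1 - \<alpha> * L) * (norm g)\<^sup>2"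
    using smooth unfolding V expand by (rule combine)
  \<comment> \<open>The step size restriction lets the remaining squared gradient be
    dropped.\<close>
  moreover have "0 \<le> \<alpha> / 2 * (1 - \<alpha> * L) * (norm g)\<^sup>2"
    using assms by simp
  ultimately show ?thesis
    using contraction by (simp add: s_def p0_def g_def Y_def U_def)
qed

section \<open>From independent sigma-algebras to expectations of inner products\<close>

lemma (in prob_space) indep_var_of_indep_set:
  assumes ind: "indep_set (sets F) (sets G)"
    and F: "space F = space M" "sets F \<subseteq> sets M" and G: "space G = space M" "sets G \<subseteq> sets M"
    and X: "X \<in> measurable F S" and Y: "Y \<in> measurable G T"
  shows "indep_var S X T Y"
proof -
  have sub: "subalgebra M F" "subalgebra M G" using F G by (auto simp: subalgebra_def)
  \<comment> \<open>Measurability places each generated sigma-algebra inside the given one, and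
    independence passes to subfamilies.\<close>
  have "sigma_sets (space M) {X -` A \<inter> space M |A. A \<in> sets S} \<subseteq> sets F"
    using sets.sigma_sets_subset[of "{X -` A \<inter> space M |A. A \<in> sets S}" F] measurable_sets[OF X] F
    by auto
  moreover have "sigma_sets (space M) {Y -` A \<inter> space M |A. A \<in> sets T} \<subseteq> sets G"
    using sets.sigma_sets_subset[of "{Y -` A \<inter> space M |A. A \<in> sets T}" G] measurable_sets[OF Y] G
    by auto
  ultimately have "indep_set (sigma_sets (space M) {X -` A \<inter> space M |A. A \<in> sets S})
      (sigma_sets (space M) {Y -` A \<inter> space M |A. A \<in> sets T})"
    using ind unfolding indep_set_def
    by (elim indep_sets_mono_sets) (auto split: bool.split)
  then show ?thesis
    unfolding indep_var_eq
    using measurable_from_subalg[OF sub(1) X] measurable_from_subalg[OF sub(2) Y] by simp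
qed

text \<open>The product rule for independent real variables is applied in each coordinate and summed
  over the basis. It also supplies integrability of the products, so first moments of the factors
  suffice.\<close>

lemma (in prob_space) indep_set_inner_expectation:
  fixes X Y :: "'a \<Rightarrow> 'b::euclidean_space"
  assumes ind: "indep_set (sets F) (sets G)"
    and F: "space F = space M" "sets F \<subseteq> sets M" and G: "space G = space M" "sets G \<subseteq> sets M"
    and X: "X \<in> borel_measurable F" "integrable M X"
    and Y: "Y \<in> borel_measurable G" "integrable M Y"
  shows "has_bochner_integral M (\<lambda>\<omega>. X \<omega> \<bullet> Y \<omega>) (expectation X \<bullet> expectation Y)"
proof -
  have "has_bochner_integral M (\<lambda>\<omega>. (X \<omega> \<bullet> b) * (Y \<omega> \<bullet> b)) ((expectation X \<bullet> b) * (expectation Y \<bullet> b))"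
    if "b \<in> Basis" for b
  proof -
    have iv: "indep_var borel (\<lambda>\<omega>. X \<omega> \<bullet> b) borel (\<lambda>\<omega>. Y \<omega> \<bullet> b)"
      by (intro indep_var_of_indep_set[OF ind F G] borel_measurable_inner borel_measurable_const X Y)
    show ?thesis
      using indep_var_integrable[OF iv] indep_var_lebesgue_integral[OF iv] X Y
      by (simp add: has_bochner_integral_iff)
  qed
  then have "has_bochner_integral M (\<lambda>\<omega>. \<Sum>b\<in>Basis. (X \<omega> \<bullet> b) * (Y \<omega> \<bullet> b))
      (\<Sum>b\<in>Basis. (expectation X \<bullet> b) * (expectation Y \<bullet> b))"
    by (intro has_bochner_integral_sum)
  then show ?thesis by (simp add: euclidean_inner[symmetric])
qed

section \<open>Random vectors with finite second moment\<close>

definition square_integrable :: "'a measure \<Rightarrow> ('a \<Rightarrow> 'b::euclidean_space) \<Rightarrow> bool" where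
  "square_integrable M X \<longleftrightarrow> X \<in> borel_measurable M \<and> integrable M (\<lambda>\<omega>. (norm (X \<omega>))\<^sup>2)"

lemma square_integrable_cong:
  assumes "\<And>\<omega>. \<omega> \<in> space M \<Longrightarrow> X \<omega> = Y \<omega>"
  shows "square_integrable M X \<longleftrightarrow> square_integrable M Y"
  unfolding square_integrable_def
  by (intro arg_cong2[where f = "(\<and>)"] measurable_cong Bochner_Integration.integrable_cong refl)
    (simp_all add: assms)

lemma (in finite_measure) square_integrable_const: "square_integrable M (\<lambda>_. c)"
  by (simp add: square_integrable_def)

text \<open>Serves for the gradient along the iteration, whose norm grows at most linearly in the
  distance to the minimizer.\<close>

lemma square_integrable_le:
  assumes "square_integrable M X" and "Y \<in> borel_measurable M" and "\<And>\<omega>. norm (Y \<omega>) \<le> C * norm (X \<omega>)"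
  shows "square_integrable M Y"
  unfolding square_integrable_def
proof
  show "integrable M (\<lambda>\<omega>. (norm (Y \<omega>))\<^sup>2)"
  proof (rule Bochner_Integration.integrable_bound)
    show "integrable M (\<lambda>\<omega>. C\<^sup>2 * (norm (X \<omega>))\<^sup>2)"
      using assms(1) by (simp add: square_integrable_def)
    have "(norm (Y \<omega>))\<^sup>2 \<le> C\<^sup>2 * (norm (X \<omega>))\<^sup>2" for \<omega>
      using power_mono[OF assms(3), of \<omega> 2] by (simp add: power_mult_distrib)
    then show "AE \<omega> in M. norm ((norm (Y \<omega>))\<^sup>2) \<le> norm (C\<^sup>2 * (norm (X \<omega>))\<^sup>2)" by simp
  qed (use assms(2) in measurable)
qed (rule assms(2))

lemma square_integrable_scaleR:
  assumes "square_integrable M X"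
  shows "square_integrable M (\<lambda>\<omega>. c *\<^sub>R X \<omega>)"
  using assms by (auto simp: square_integrable_def power_mult_distrib)

lemma square_integrable_add:
  fixes X Y :: "'a \<Rightarrow> 'b::euclidean_space"
  assumes "square_integrable M X" and "square_integrable M Y"
  shows "square_integrable M (\<lambda>\<omega>. X \<omega> + Y \<omega>)"
  unfolding square_integrable_def
proof
  have [measurable]: "X \<in> borel_measurable M" "Y \<in> borel_measurable M"
    using assms by (simp_all add: square_integrable_def)
  show "(\<lambda>\<omega>. X \<omega> + Y \<omega>) \<in> borel_measurable M" by measurable
  show "integrable M (\<lambda>\<omega>. (norm (X \<omega> + Y \<omega>))\<^sup>2)"
  proof (rule Bochner_Integration.integrable_bound)
    show "integrable M (\<lambda>\<omega>. 2 * (norm (X \<omega>))\<^sup>2 + 2 * (norm (Y \<omega>))\<^sup>2)"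
      using assms by (simp add: square_integrable_def)
    have "(norm (a + b))\<^sup>2 \<le> 2 * (norm a)\<^sup>2 + 2 * (norm b)\<^sup>2" for a b :: 'b
      using zero_le_power2[of "norm (a - b)"] unfolding power2_norm_eq_inner
      by (simp add: inner_add inner_diff inner_commute)
    then show "AE \<omega> in M. norm ((norm (X \<omega> + Y \<omega>))\<^sup>2) \<le> norm (2 * (norm (X \<omega>))\<^sup>2 + 2 * (norm (Y \<omega>))\<^sup>2)"
      by simp
  qed measurable
qed

lemma square_integrable_diff:
  assumes "square_integrable M X" and "square_integrable M Y"
  shows "square_integrable M (\<lambda>\<omega>. X \<omega> - Y \<omega>)"
  using square_integrable_add[OF assms(1) square_integrable_scaleR[OF assms(2), of "- 1"]] by simp

lemma (in finite_measure) integrable_of_square_integrable: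
  assumes "square_integrable M X"
  shows "integrable M X"
proof (rule Bochner_Integration.integrable_bound)
  show "integrable M (\<lambda>\<omega>. 1 + (norm (X \<omega>))\<^sup>2)" "X \<in> borel_measurable M"
    using assms by (simp_all add: square_integrable_def)
  have "r \<le> 1 + r\<^sup>2" for r :: real
    using sum_squares_bound[of r 1] zero_le_power2[of r] by (simp only: power_one mult_1_right)
  then show "AE \<omega> in M. norm (X \<omega>) \<le> norm (1 + (norm (X \<omega>))\<^sup>2)" by simp
qed

section \<open>Second moment of the noise and measurability with respect to the past\<close>

lemma has_bochner_integral_trace_outer_prod:
  fixes w :: "'a \<Rightarrow> real ^ 'd"
  assumes "has_bochner_integral M (\<lambda>\<omega>. outer_prod (w \<omega>) (w \<omega>)) A"
  shows "has_bochner_integral M (\<lambda>\<omega>. (norm (w \<omega>))\<^sup>2) (trace A)"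
proof -
  \<comment> \<open>The trace is a sum of bounded linear functionals, hence commutes with the
    integral, and the trace of an outer square is the squared norm.\<close>
  have "bounded_linear (\<lambda>A :: real^'d^'d. A $ i $ i)" for i
    by (rule bounded_linear_compose[OF bounded_linear_vec_nth bounded_linear_vec_nth])
  then have "has_bochner_integral M (\<lambda>\<omega>. \<Sum>i\<in>UNIV. outer_prod (w \<omega>) (w \<omega>) $ i $ i) (\<Sum>i\<in>UNIV. A $ i $ i)"
    by (intro has_bochner_integral_sum has_bochner_integral_bounded_linear[OF _ assms])
  then show ?thesis
    by (simp add: outer_prod_def trace_def power2_norm_eq_inner inner_vec_def)
qed

text \<open>Each component is a coordinate projection after the tuple map, which is measurable for
  the sigma-algebra it generates. The second premise ensures that the tuple lands in the product
  space.\<close>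

lemma measurable_component_vimage_algebra:
  assumes "i \<in> I" and "\<And>j \<omega>. j \<in> I \<Longrightarrow> \<omega> \<in> \<Omega> \<Longrightarrow> Z j \<omega> \<in> space (N j)"
  shows "Z i \<in> measurable (vimage_algebra \<Omega> (\<lambda>\<omega>. \<lambda>j\<in>I. Z j \<omega>) (PiM I N)) (N i)"
proof -
  have "(\<lambda>\<omega>. \<lambda>j\<in>I. Z j \<omega>) \<in> measurable (vimage_algebra \<Omega> (\<lambda>\<omega>. \<lambda>j\<in>I. Z j \<omega>) (PiM I N)) (PiM I N)"
    using assms by (intro measurable_vimage_algebra1) (auto simp: space_PiM PiE_iff)
  then have "(\<lambda>\<omega>. (\<lambda>j\<in>I. Z j \<omega>) i) \<in> measurable (vimage_algebra \<Omega> (\<lambda>\<omega>. \<lambda>j\<in>I. Z j \<omega>) (PiM I N)) (N i)"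
    by (rule measurable_compose) (rule measurable_component_singleton[OF assms(1)])
  then show ?thesis using assms(1) by simp
qed

lemma continuous_on_stack: "continuous_on UNIV (\<lambda>p. stack (fst p) (snd p))"
proof -
  have "continuous_on UNIV (\<lambda>p. if b then fst p $ i else snd p $ i)" for b and i :: "'d::finite"
    by (cases b) (auto intro!: continuous_intros)
  then show ?thesis unfolding stack_def by (rule continuous_on_vec_lambda)
qed

section \<open>Affine recursion, rate constants and the limit superior\<close>

lemma affine_recursion_bound:
  fixes e :: "nat \<Rightarrow> real"
  assumes "\<And>k. e (Suc k) \<le> r * e k + (1 - r) * c" and "0 \<le> r"
  shows "e k \<le> r ^ k * e 0 + (1 - r ^ k) * c"
proof (induction k)
  case (Suc k)
  have "e (Suc k) \<le> r * e k + (1 - r) * c" by (rule assms)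
  also have "r * e k \<le> r * (r ^ k * e 0 + (1 - r ^ k) * c)"
    using Suc assms(2) by (rule mult_left_mono)
  finally show ?case by (simp add: algebra_simps)
qed simp

text \<open>An even power removes the outer root, whose radicand is nonnegative by the premise. If
  \<alpha> \<mu> = 1, both bases are 0 and the convention 0^0 = 1 covers
  \<open>k = 0\<close>.\<close>

lemma AG_rho_even_power:
  assumes "\<alpha> * \<mu> \<le> 1"
  shows "AG_rho \<mu> \<alpha> ^ (2 * k) = (1 - sqrt (\<alpha> * \<mu>)) ^ k"
  using assms by (simp add: AG_rho_def power_mult)

text \<open>Both forms rest on 1 - rho^2 = sqrt(\<alpha> \<mu>). The first matches the noise
  constant of the recursion, the second is the closed form in the theorem.\<close>

lemma AG_R_eq:
  assumes "0 < \<alpha>" "0 < \<mu>" "\<alpha> * \<mu> \<le> 1"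
  shows "AG_R \<mu> L d \<alpha> = \<alpha> * real d / (2 * sqrt (\<alpha> * \<mu>)) * (1 + \<alpha> * L)"
    and "AG_R \<mu> L d \<alpha> = sqrt \<alpha> * real d / (2 * sqrt \<mu>) * (1 + \<alpha> * L)"
proof -
  show R: "AG_R \<mu> L d \<alpha> = \<alpha> * real d / (2 * sqrt (\<alpha> * \<mu>)) * (1 + \<alpha> * L)"
    using AG_rho_even_power[OF assms(3), of 1] by (simp add: AG_R_def)
  have "\<alpha> / sqrt (\<alpha> * \<mu>) = sqrt \<alpha> / sqrt \<mu>"
    using assms by (simp add: real_sqrt_mult field_simps)
  then have "\<alpha> / sqrt (\<alpha> * \<mu>) * (real d / 2 * (1 + \<alpha> * L)) = sqrt \<alpha> / sqrt \<mu> * (real d / 2 * (1 + \<alpha> * L))"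
    by simp
  then show "AG_R \<mu> L d \<alpha> = sqrt \<alpha> * real d / (2 * sqrt \<mu>) * (1 + \<alpha> * L)"
    unfolding R by (simp add: mult.commute mult.left_commute)
qed

lemma limsup_le_of_geometric_bound:
  fixes a :: "nat \<Rightarrow> real"
  assumes "\<And>k. a k \<le> r ^ k * v + (1 - r ^ k) * c" and "0 \<le> r" "r < 1"
  shows "limsup (\<lambda>k. ereal (a k)) \<le> ereal c"
proof -
  have "(\<lambda>k. r ^ k * v + (1 - r ^ k) * c) \<longlonglongrightarrow> 0 * v + (1 - 0) * c"
    using assms(2,3) by (intro tendsto_intros LIMSEQ_realpow_zero)
  then have "(\<lambda>k. ereal (r ^ k * v + (1 - r ^ k) * c)) \<longlonglongrightarrow> ereal c" by simp
  then have "limsup (\<lambda>k. ereal (r ^ k * v + (1 - r ^ k) * c)) = ereal c"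
    by (rule lim_imp_Limsup[OF sequentially_bot])
  moreover have "limsup (\<lambda>k. ereal (a k)) \<le> limsup (\<lambda>k. ereal (r ^ k * v + (1 - r ^ k) * c))"
    using assms(1) by (intro Limsup_mono) simp
  ultimately show ?thesis by simp
qed

section \<open>The bound in expectation for the noisy iteration\<close>

theorem corollary4p9:
  fixes M :: "'w measure"
    and f :: "real ^ 'd \<Rightarrow> real"
    and xstar x0 xm1 :: "real ^ 'd"
    and x :: "int \<Rightarrow> 'w \<Rightarrow> real ^ 'd"
    and y w :: "nat \<Rightarrow> 'w \<Rightarrow> real ^ 'd"
    and \<mu> L \<alpha> \<sigma> :: real
  assumes "prob_space M"
    and "0 < \<mu>" and "\<mu> \<le> L"
    and "f \<in> smooth_strongly_convex \<mu> L"
    and "\<forall>z. f xstar \<le> f z"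
    and "0 < \<alpha>" and "\<alpha> \<le> 1 / L"
    and "0 < \<sigma>"
    and "\<forall>\<omega>\<in>space M. x 0 \<omega> = x0 \<and> x (-1) \<omega> = xm1"
    and "\<forall>k. \<forall>\<omega>\<in>space M.
           y k \<omega> = (1 + AG_beta \<mu> \<alpha>) *\<^sub>R x (int k) \<omega> - AG_beta \<mu> \<alpha> *\<^sub>R x (int k - 1) \<omega>"
    and "\<forall>k. \<forall>\<omega>\<in>space M.
           x (int k + 1) \<omega> = y k \<omega> - \<alpha> *\<^sub>R (grad f (y k \<omega>) + w k \<omega>)"
    and "noise_assumption M \<sigma> (\<lambda>k \<omega>. stack (x (int k) \<omega>) (x (int k - 1) \<omega>)) y w"
  shows "(\<forall>k::nat.
            integrable M (\<lambda>\<omega>. f (x (int k) \<omega>) - f xstar) \<and>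
            (LINT \<omega>|M. f (x (int k) \<omega>) - f xstar)
              \<le> AG_rho \<mu> \<alpha> ^ (2 * k) * V_P1 (P_mat \<mu> \<alpha>) f xstar x0 xm1
                + (1 - AG_rho \<mu> \<alpha> ^ (2 * k)) * \<sigma>\<^sup>2 * AG_R \<mu> L CARD('d) \<alpha>)
       \<and> noise_robustness M \<sigma> f xstar x \<le> ereal (AG_R \<mu> L CARD('d) \<alpha>)
       \<and> AG_R \<mu> L CARD('d) \<alpha> = sqrt \<alpha> * real CARD('d) / (2 * sqrt \<mu>) * (1 + \<alpha> * L)"
proof -
  interpret prob_space M by fact
  note f = assms(4) and min = assms(5) and init = assms(9) and y_def = assms(10)
    and x_Suc = assms(11) and noise = assms(12)
  define s where "s = sqrt (\<alpha> * \<mu>)"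
  \<comment> \<open>\<open>H\<close> is the coefficient of the noise in
    \<open>lyapunov_step\<close>; \<open>G k\<close> is the past from which \<open>w k\<close> is
    independent.\<close>
  define H where "H u v = (L * \<alpha>\<^sup>2) *\<^sub>R grad f v - ((v - xstar) - (1 - s) *\<^sub>R (u - xstar))" for u v
  define G where "G k = vimage_algebra (space M)
      (\<lambda>\<omega>. \<lambda>i\<in>{1..k}. (stack (x (int i) \<omega>) (x (int i - 1) \<omega>), y i \<omega>)) (PiM {1..k} (\<lambda>_. borel))" for k
  define V where "V k \<omega> = lyapunov \<mu> \<alpha> f xstar (x (int k) \<omega>) (x (int k - 1) \<omega>)" for k \<omega>

  have pos: "0 < \<mu>" "0 < L" "0 < \<alpha>" "\<alpha> * L \<le> 1"
    using assms(2,3,6,7) by (auto simp: field_simps)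
  have "\<alpha> * \<mu> \<le> \<alpha> * L" using assms(3,6) by simp
  then have \<alpha>\<mu>: "\<alpha> * \<mu> \<le> 1" using pos(4) by linarith
  have s: "0 < s" "s \<le> 1" using pos \<alpha>\<mu> by (simp_all add: s_def)
  have cont_grad: "continuous_on UNIV (grad f)" and cont_f: "continuous_on UNIV f"
    using smooth_strongly_convexD[OF f] by auto
  have [measurable]: "grad f \<in> borel_measurable borel" "f \<in> borel_measurable borel"
    using cont_grad cont_f by (auto intro: borel_measurable_continuous_onI)

  have w: "w k \<in> borel_measurable M" "has_bochner_integral M (w k) 0"
      "has_bochner_integral M (\<lambda>\<omega>. outer_prod (w k \<omega>) (w k \<omega>)) (\<sigma>\<^sup>2 *\<^sub>R mat 1)"
      "indep_set (sets (vimage_algebra (space M) (w k) borel)) (sets (G k))" for k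
    using noise unfolding noise_assumption_def G_def by blast+
  \<comment> \<open>The dimension enters here, as the trace of the identity.\<close>
  have w_power2: "has_bochner_integral M (\<lambda>\<omega>. (norm (w k \<omega>))\<^sup>2) (\<sigma>\<^sup>2 * CARD('d))" for k
    using has_bochner_integral_trace_outer_prod[OF w(3)[of k]] by (simp add: trace_def mat_def mult.commute)
  have w_sq: "square_integrable M (w k)" for k
    using w(1)[of k] w_power2[of k] by (simp add: square_integrable_def has_bochner_integral_iff)

  have grad_sq: "square_integrable M (\<lambda>\<omega>. grad f (Y \<omega>))" if "square_integrable M Y" for Y
  proof (rule square_integrable_le)
    show "square_integrable M (\<lambda>\<omega>. Y \<omega> - xstar)"
      using that square_integrable_const by (rule square_integrable_diff)
    have [measurable]: "Y \<in> borel_measurable M" using that by (simp add: square_integrable_def)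
    show "(\<lambda>\<omega>. grad f (Y \<omega>)) \<in> borel_measurable M" by measurable
    show "norm (grad f (Y \<omega>)) \<le> L * norm (Y \<omega> - xstar)" for \<omega>
      by (rule norm_grad_le_of_minimizer(2)[OF f pos(2) min])
  qed
  have y_sq_of: "square_integrable M (y k)"
    if "square_integrable M (x (int k))" "square_integrable M (x (int k - 1))" for k
    using that square_integrable_cong[of M "y k"] y_def
    by (simp add: square_integrable_diff square_integrable_scaleR)
  \<comment> \<open>Two successive iterates are carried along because the extrapolated point depends
    on both.\<close>
  have x_sq: "square_integrable M (x (int k)) \<and> square_integrable M (x (int k - 1))" for k
  proof (induction k)
    case 0
    have "square_integrable M (x 0)" "square_integrable M (x (- 1))"
      using init square_integrable_cong[of M "x 0" "\<lambda>_. x0"] square_integrable_cong[of M "x (-1)" "\<lambda>_. xm1"]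
      by (simp_all add: square_integrable_const)
    then show ?case by simp
  next
    case (Suc k)
    then have "square_integrable M (y k)" using y_sq_of by blast
    then have "square_integrable M (\<lambda>\<omega>. y k \<omega> - \<alpha> *\<^sub>R (grad f (y k \<omega>) + w k \<omega>))"
      by (intro square_integrable_diff square_integrable_scaleR square_integrable_add grad_sq w_sq)
    then have "square_integrable M (x (int k + 1))"
      using square_integrable_cong[of M "x (int k + 1)"] x_Suc by simp
    then show ?case using Suc by (simp add: add.commute)
  qed
  have y_sq: "square_integrable M (y k)" for k using x_sq y_sq_of by blast
  have meas [measurable]: "x (int k) \<in> borel_measurable M" "x (int k - 1) \<in> borel_measurable M"
    "y k \<in> borel_measurable M" for k
    using x_sq y_sq by (auto simp: square_integrable_def)

  have f_int: "integrable M (\<lambda>\<omega>. f (x (int k) \<omega>) - f xstar)" for k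
  proof (rule Bochner_Integration.integrable_bound)
    show "integrable M (\<lambda>\<omega>. L / 2 * (norm (x (int k) \<omega> - xstar))\<^sup>2)"
      using square_integrable_diff[OF conjunct1[OF x_sq] square_integrable_const, of k xstar]
      by (simp add: square_integrable_def)
    \<comment> \<open>Minimality makes the gap nonnegative, so the quadratic upper bound controls
      its absolute value.\<close>
    have "\<bar>f (x (int k) \<omega>) - f xstar\<bar> \<le> \<bar>L / 2 * (norm (x (int k) \<omega> - xstar))\<^sup>2\<bar>" for \<omega>
      using norm_grad_le_of_minimizer(1)[OF f pos(2) min, of "x (int k) \<omega>"] min[rule_format, of "x (int k) \<omega>"]
      by linarith
    then show "AE \<omega> in M. norm (f (x (int k) \<omega>) - f xstar)
        \<le> norm (L / 2 * (norm (x (int k) \<omega> - xstar))\<^sup>2)" by simp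
  qed measurable
  have V_int: "integrable M (V k)" for k
  proof -
    have "square_integrable M (\<lambda>\<omega>. (x (int k) \<omega> - xstar) - (1 - s) *\<^sub>R (x (int k - 1) \<omega> - xstar))"
      using x_sq by (intro square_integrable_diff square_integrable_scaleR square_integrable_const) auto
    then have "integrable M (\<lambda>\<omega>. (norm ((x (int k) \<omega> - xstar) - (1 - s) *\<^sub>R (x (int k - 1) \<omega> - xstar)))\<^sup>2 / (2 * \<alpha>)
        + (f (x (int k) \<omega>) - f xstar))"
      using f_int by (auto simp: square_integrable_def)
    then show ?thesis unfolding V_def[abs_def] lyapunov_def s_def by (simp add: add_diff_eq)
  qed

  have cross: "has_bochner_integral M (\<lambda>\<omega>. w k \<omega> \<bullet> H (x (int k) \<omega>) (y k \<omega>)) 0" for k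
  proof -
    have H_meas: "(\<lambda>\<omega>. H (x (int k) \<omega>) (y k \<omega>)) \<in> borel_measurable (G k)"
    proof (cases "k = 0")
      \<comment> \<open>For \<open>k = 0\<close> the noise assumption says nothing about \<open>y 0\<close>, but the initial data are deterministic.\<close>
      case True
      have "H (x (int k) \<omega>) (y k \<omega>) = H x0 ((1 + AG_beta \<mu> \<alpha>) *\<^sub>R x0 - AG_beta \<mu> \<alpha> *\<^sub>R xm1)"
        if "\<omega> \<in> space (G k)" for \<omega>
        using that True init y_def by (simp add: G_def)
      then show ?thesis by (subst measurable_cong) auto
    next
      case False
      \<comment> \<open>Recovering the current iterate from the stacked vector exhibits
        \<open>H\<close> as a continuous function of the last pair generating
        \<open>G k\<close>.\<close>
      define current where "current z = (\<chi> i. z $ (1, i))" for z :: "real ^ (2 \<times> 'd)"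
      have current: "current (stack u v) = u" for u v by (simp add: current_def stack_def vec_eq_iff)
      have "continuous_on UNIV (\<lambda>z. H (current (fst z)) (snd z))"
        unfolding H_def current_def
        by (intro continuous_intros continuous_on_compose2[OF cont_grad]) auto
      then have H_current: "(\<lambda>z. H (current (fst z)) (snd z)) \<in> borel_measurable borel"
        by (rule borel_measurable_continuous_onI)
      have "(\<lambda>\<omega>. (stack (x (int k) \<omega>) (x (int k - 1) \<omega>), y k \<omega>)) \<in> borel_measurable (G k)"
        unfolding G_def using False
        by (intro measurable_component_vimage_algebra[where Z = "\<lambda>k \<omega>. (stack (x (int k) \<omega>) (x (int k - 1) \<omega>), y k \<omega>)"
              and N = "\<lambda>_. borel"]) auto
      from measurable_compose[OF this H_current] show ?thesis by (simp add: current)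
    qed
    have stack_meas: "(\<lambda>\<omega>. (stack (x (int i) \<omega>) (x (int i - 1) \<omega>), y i \<omega>)) \<in> borel_measurable M" for i
      by (intro borel_measurable_Pair meas borel_measurable_continuous_Pair[where H = stack] continuous_on_stack)
    have H_sq: "square_integrable M (\<lambda>\<omega>. H (x (int k) \<omega>) (y k \<omega>))"
      unfolding H_def using x_sq y_sq
      by (intro square_integrable_diff square_integrable_scaleR square_integrable_const grad_sq) auto
    have "has_bochner_integral M (\<lambda>\<omega>. w k \<omega> \<bullet> H (x (int k) \<omega>) (y k \<omega>))
        (expectation (w k) \<bullet> expectation (\<lambda>\<omega>. H (x (int k) \<omega>) (y k \<omega>)))"
    proof (rule indep_set_inner_expectation[OF w(4)])
      show "sets (vimage_algebra (space M) (w k) borel) \<subseteq> sets M"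
        by (rule sets_image_in_sets[OF refl w(1)])
      show "sets (G k) \<subseteq> sets M" unfolding G_def
        by (intro sets_image_in_sets[OF refl] measurable_restrict stack_meas)
      show "w k \<in> borel_measurable (vimage_algebra (space M) (w k) borel)"
        by (rule measurable_vimage_algebra1) simp
    qed (use H_meas integrable_of_square_integrable[OF H_sq] integrable_of_square_integrable[OF w_sq]
        in \<open>auto simp: G_def\<close>)
    moreover have "expectation (w k) = 0"
      using w(2) by (rule has_bochner_integral_integral_eq)
    ultimately show ?thesis by simp
  qed

  have step: "expectation (V (Suc k)) \<le> (1 - s) * expectation (V k)
      + (1 - (1 - s)) * (\<sigma>\<^sup>2 * AG_R \<mu> L CARD('d) \<alpha>)" for k
  proof -
    \<comment> \<open>\<open>B\<close> is the pathwise bound from \<open>lyapunov_step\<close>; by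
      \<open>cross\<close> its linear noise term contributes 0 to the expectation.\<close>
    define B where "B \<omega> = (1 - s) * V k \<omega> + w k \<omega> \<bullet> H (x (int k) \<omega>) (y k \<omega>)
      + \<alpha> / 2 * (1 + \<alpha> * L) * (norm (w k \<omega>))\<^sup>2" for \<omega>
    have "has_bochner_integral M B ((1 - s) * expectation (V k) + 0
        + \<alpha> / 2 * (1 + \<alpha> * L) * (\<sigma>\<^sup>2 * CARD('d)))"
      unfolding B_def[abs_def]
      by (intro has_bochner_integral_add has_bochner_integral_mult_right cross w_power2
          has_bochner_integral_integrable V_int)
    moreover have "V (Suc k) \<omega> \<le> B \<omega>" if "\<omega> \<in> space M" for \<omega>
      using lyapunov_step[OF f pos(1,3) \<alpha>\<mu> pos(4), of "y k \<omega>" "x (int k) \<omega>" "x (int k - 1) \<omega>"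
          "x (int k + 1) \<omega>" "w k \<omega>" xstar] that y_def x_Suc
      by (simp add: V_def B_def H_def s_def add.commute)
    ultimately have "expectation (V (Suc k)) \<le> (1 - s) * expectation (V k)
        + \<alpha> / 2 * (1 + \<alpha> * L) * (\<sigma>\<^sup>2 * CARD('d))"
      using integral_mono[OF V_int[of "Suc k"], of B] by (simp add: has_bochner_integral_iff)
    \<comment> \<open>\<open>AG_R\<close> has s in its denominator, so the noise constant becomes s
      times the limit level, the form that \<open>affine_recursion_bound\<close> expects with r = 1
      - s.\<close>
    also have "\<alpha> / 2 * (1 + \<alpha> * L) * (\<sigma>\<^sup>2 * CARD('d)) = (1 - (1 - s)) * (\<sigma>\<^sup>2 * AG_R \<mu> L CARD('d) \<alpha>)"
      unfolding AG_R_eq(1)[OF pos(3,1) \<alpha>\<mu>] s_def[symmetric] using s by simp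
    finally show ?thesis .
  qed
  have V0: "expectation (V 0) = V_P1 (P_mat \<mu> \<alpha>) f xstar x0 xm1"
  proof -
    have "expectation (V 0) = expectation (\<lambda>_. lyapunov \<mu> \<alpha> f xstar x0 xm1)"
      using init by (intro Bochner_Integration.integral_cong) (simp_all add: V_def)
    then show ?thesis using pos by (simp add: V_P1_eq_lyapunov prob_space)
  qed
  have bound: "expectation (\<lambda>\<omega>. f (x (int k) \<omega>) - f xstar) \<le>
      (1 - s) ^ k * V_P1 (P_mat \<mu> \<alpha>) f xstar x0 xm1
      + (1 - (1 - s) ^ k) * (\<sigma>\<^sup>2 * AG_R \<mu> L CARD('d) \<alpha>)" for k
  proof -
    \<comment> \<open>The nonnegative quadratic part of \<open>V k\<close> is dropped.\<close>
    have "expectation (\<lambda>\<omega>. f (x (int k) \<omega>) - f xstar) \<le> expectation (V k)"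
      using pos by (intro integral_mono f_int V_int) (simp add: V_def lyapunov_def)
    also have "\<dots> \<le> (1 - s) ^ k * expectation (V 0) + (1 - (1 - s) ^ k) * (\<sigma>\<^sup>2 * AG_R \<mu> L CARD('d) \<alpha>)"
      using step s by (intro affine_recursion_bound[where e = "\<lambda>k. expectation (V k)"]) auto
    finally show ?thesis by (simp add: V0)
  qed
  have "noise_robustness M \<sigma> f xstar x \<le> ereal (AG_R \<mu> L CARD('d) \<alpha>)"
    unfolding noise_robustness_def
  proof (rule limsup_le_of_geometric_bound)
    show "1 / \<sigma>\<^sup>2 * expectation (\<lambda>\<omega>. f (x (int k) \<omega>) - f xstar) \<le>
      (1 - s) ^ k * (V_P1 (P_mat \<mu> \<alpha>) f xstar x0 xm1 / \<sigma>\<^sup>2) + (1 - (1 - s) ^ k) * AG_R \<mu> L CARD('d) \<alpha>" for k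
      using divide_right_mono[OF bound[of k], of "\<sigma>\<^sup>2"] assms(8) by (simp add: add_divide_distrib)
  qed (use s in simp_all)
  then show ?thesis
    using f_int bound AG_R_eq(2)[OF pos(3,1) \<alpha>\<mu>]
    by (simp add: AG_rho_even_power[OF \<alpha>\<mu>] s_def[symmetric] mult.assoc)
qed

end
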